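(* Let $L_1,L_2>0$, $\Omega=(0,L_1)\times(0,L_2)$, and $\alpha_1,\alpha_2,\beta_1,\beta_2\in\mathbb{R}$ with $\alpha_1,\alpha_2>0$ and $\alpha_2\beta_1-\alpha_1\beta_2\ne0$. Let $\mathcal{T}$ be the unbounded operator on $L^2(\Omega)^2$ given by $\mathcal{T}\Theta=T_1\Theta_x+T_2\Theta_y$, $T_1=\begin{pmatrix}\alpha_1&\beta_1\\ \beta_1&-\alpha_1\end{pmatrix}$, $T_2=\begin{pmatrix}\alpha_2&\beta_2\\ \beta_2&-\alpha_2\end{pmatrix}$, with domain $\mathcal{D}(\mathcal{T})$ described in the context, and let $\mathcal{T}^*$ be its Hilbert-space adjoint with domain $\mathcal{D}(\mathcal{T}^* )$. Then $\mathcal{T}^*$ is positive: $\langle\mathcal{T}^*\overline\Theta,\overline\Theta\rangle_{L^2(\Omega)^2}\ge0$ for every $\overline\Theta\in\mathcal{D}(\mathcal{T}^* )$.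
   Context: $\Gamma_W=\{x=0\}$, $\Gamma_E=\{x=L_1\}$, $\Gamma_S=\{y=0\}$, $\Gamma_N=\{y=L_2\}$. $\mathcal{D}(\mathcal{T})=\{\Theta=(\theta_1,\theta_2)^t\in L^2(\Omega)^2:\ \mathcal{T}\Theta\in L^2(\Omega)^2,\ \theta_1=0\text{ on }\Gamma_W\cup\Gamma_S,\ \theta_2=0\text{ on }\Gamma_E\cup\Gamma_N\}$, derivatives in the distribution sense and boundary values as traces in $H^{-1}$ of each side. *)

theory Defs
  imports "HOL-Analysis.Analysis"
begin

definition Omega :: "real \<Rightarrow> real \<Rightarrow> (real \<times> real) set" where
  "Omega L1 L2 = {0<..<L1} \<times> {0<..<L2}"

definition Tmat :: "real \<Rightarrow> real \<Rightarrow> real \<times> real \<Rightarrow> real \<times> real" where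
  "Tmat a b v = (a * fst v + b * snd v, b * fst v - a * snd v)"

definition dx :: "(real \<times> real \<Rightarrow> real \<times> real) \<Rightarrow> real \<times> real \<Rightarrow> real \<times> real" where
  "dx f p = frechet_derivative f (at p) (1, 0)"

definition dy :: "(real \<times> real \<Rightarrow> real \<times> real) \<Rightarrow> real \<times> real \<Rightarrow> real \<times> real" where
  "dy f p = frechet_derivative f (at p) (0, 1)"

coinductive smooth2 :: "(real \<times> real \<Rightarrow> real \<times> real) \<Rightarrow> bool" where
  "(\<forall>p. f differentiable (at p)) \<Longrightarrow> smooth2 (dx f) \<Longrightarrow> smooth2 (dy f) \<Longrightarrow> smooth2 f"

definition test_fun :: "(real \<times> real) set \<Rightarrow> (real \<times> real \<Rightarrow> real \<times> real) \<Rightarrow> bool" where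
  "test_fun U \<phi> \<longleftrightarrow> smooth2 \<phi> \<and> compact (closure {p. \<phi> p \<noteq> 0})
                     \<and> closure {p. \<phi> p \<noteq> 0} \<subseteq> U"

text \<open>Test fields for a side: smooth fields on the plane with compact support, whose
  support meets the closed rectangle only inside U (U = Omega plus one open side).
  Only their restriction to the closed rectangle matters.\<close>
definition side_test :: "real \<Rightarrow> real \<Rightarrow> (real \<times> real) set \<Rightarrow> (real \<times> real \<Rightarrow> real \<times> real) \<Rightarrow> bool" where
  "side_test L1 L2 U \<phi> \<longleftrightarrow> smooth2 \<phi> \<and> compact (closure {p. \<phi> p \<noteq> 0})
                     \<and> closure {p. \<phi> p \<noteq> 0} \<inter> ({0..L1} \<times> {0..L2}) \<subseteq> U"

definition in_L2 :: "(real \<times> real) set \<Rightarrow> (real \<times> real \<Rightarrow> real \<times> real) \<Rightarrow> bool" where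
  "in_L2 \<Omega> f \<longleftrightarrow> f \<in> borel_measurable (lebesgue_on \<Omega>)
                 \<and> integrable (lebesgue_on \<Omega>) (\<lambda>p. (norm (f p))\<^sup>2)"

definition L2_inner :: "(real \<times> real) set \<Rightarrow> (real \<times> real \<Rightarrow> real \<times> real)
                         \<Rightarrow> (real \<times> real \<Rightarrow> real \<times> real) \<Rightarrow> real" where
  "L2_inner \<Omega> f g = (LINT p | lebesgue_on \<Omega>. f p \<bullet> g p)"

text \<open>Green functional: for Theta, F in L^2 and a smooth field Phi,
  gfun Phi = int F.Phi + int Theta.(T1 Phi_x + T2 Phi_y).
  If F = T Theta, then by Green's formula this equals the boundary pairing
  int over the boundary of ((n1 T1 + n2 T2) Theta) . Phi  (T1, T2 symmetric).\<close>
definition green :: "real \<Rightarrow> real \<Rightarrow> real \<Rightarrow> real \<Rightarrow> real \<Rightarrow> real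
     \<Rightarrow> (real \<times> real \<Rightarrow> real \<times> real) \<Rightarrow> (real \<times> real \<Rightarrow> real \<times> real)
     \<Rightarrow> (real \<times> real \<Rightarrow> real \<times> real) \<Rightarrow> real" where
  "green L1 L2 a1 b1 a2 b2 \<Theta> F \<Phi> =
     L2_inner (Omega L1 L2) F \<Phi>
     + L2_inner (Omega L1 L2) \<Theta> (\<lambda>p. Tmat a1 b1 (dx \<Phi> p) + Tmat a2 b2 (dy \<Phi> p))"

definition weak_T :: "real \<Rightarrow> real \<Rightarrow> real \<Rightarrow> real \<Rightarrow> real \<Rightarrow> real
     \<Rightarrow> (real \<times> real \<Rightarrow> real \<times> real) \<Rightarrow> (real \<times> real \<Rightarrow> real \<times> real) \<Rightarrow> bool" where
  "weak_T L1 L2 a1 b1 a2 b2 \<Theta> F \<longleftrightarrow>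
     (\<forall>\<Phi>. test_fun (Omega L1 L2) \<Phi> \<longrightarrow> green L1 L2 a1 b1 a2 b2 \<Theta> F \<Phi> = 0)"

text \<open>Boundary conditions, as traces (distributions) on each open side.
  On Gamma_W (x = 0, outer normal (-1,0)) the boundary pairing is
  - int_0^L2 Theta(0,y) . (T1 Phi)(0,y) dy, so theta1 = 0 on Gamma_W iff the Green
  functional vanishes for all test fields Phi supported in Omega \<union> Gamma_W
  whose value (T1 Phi)(0,y) has vanishing second component (then (T1 Phi)(0,.) is
  an arbitrary (psi, 0) with psi a test function on (0,L2)).  Similarly for the
  other sides.\<close>
definition bc_W where
  "bc_W L1 L2 a1 b1 a2 b2 \<Theta> F \<longleftrightarrow>
     (\<forall>\<Phi>. side_test L1 L2 ({0..<L1} \<times> {0<..<L2}) \<Phi> \<and> (\<forall>y\<in>{0<..<L2}. snd (Tmat a1 b1 (\<Phi> (0, y))) = 0)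
            \<longrightarrow> green L1 L2 a1 b1 a2 b2 \<Theta> F \<Phi> = 0)"

definition bc_S where
  "bc_S L1 L2 a1 b1 a2 b2 \<Theta> F \<longleftrightarrow>
     (\<forall>\<Phi>. side_test L1 L2 ({0<..<L1} \<times> {0..<L2}) \<Phi> \<and> (\<forall>x\<in>{0<..<L1}. snd (Tmat a2 b2 (\<Phi> (x, 0))) = 0)
            \<longrightarrow> green L1 L2 a1 b1 a2 b2 \<Theta> F \<Phi> = 0)"

definition bc_E where
  "bc_E L1 L2 a1 b1 a2 b2 \<Theta> F \<longleftrightarrow>
     (\<forall>\<Phi>. side_test L1 L2 ({0<..L1} \<times> {0<..<L2}) \<Phi> \<and> (\<forall>y\<in>{0<..<L2}. fst (Tmat a1 b1 (\<Phi> (L1, y))) = 0)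
            \<longrightarrow> green L1 L2 a1 b1 a2 b2 \<Theta> F \<Phi> = 0)"

definition bc_N where
  "bc_N L1 L2 a1 b1 a2 b2 \<Theta> F \<longleftrightarrow>
     (\<forall>\<Phi>. side_test L1 L2 ({0<..<L1} \<times> {0<..L2}) \<Phi> \<and> (\<forall>x\<in>{0<..<L1}. fst (Tmat a2 b2 (\<Phi> (x, L2))) = 0)
            \<longrightarrow> green L1 L2 a1 b1 a2 b2 \<Theta> F \<Phi> = 0)"

definition T_graph where
  "T_graph L1 L2 a1 b1 a2 b2 \<Theta> F \<longleftrightarrow>
     in_L2 (Omega L1 L2) \<Theta> \<and> in_L2 (Omega L1 L2) F \<and> weak_T L1 L2 a1 b1 a2 b2 \<Theta> F
     \<and> bc_W L1 L2 a1 b1 a2 b2 \<Theta> F \<and> bc_S L1 L2 a1 b1 a2 b2 \<Theta> F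
     \<and> bc_E L1 L2 a1 b1 a2 b2 \<Theta> F \<and> bc_N L1 L2 a1 b1 a2 b2 \<Theta> F"

definition Tadj_graph where
  "Tadj_graph L1 L2 a1 b1 a2 b2 \<Psi> G \<longleftrightarrow>
     in_L2 (Omega L1 L2) \<Psi> \<and> in_L2 (Omega L1 L2) G \<and>
     (\<forall>\<Theta> F. T_graph L1 L2 a1 b1 a2 b2 \<Theta> F \<longrightarrow>
        L2_inner (Omega L1 L2) F \<Psi> = L2_inner (Omega L1 L2) \<Theta> G)"

end

theory Submission
  imports Defs
begin

text \<open>
  Each boundary condition defining the domain of T is itself a duality relation: together with
  the weak equation they say that T is the Hilbert-space adjoint of S, where S is the formal
  operator - (T1 d/dx + T2 d/dy) on the linear span of the smooth fields that vanish near all sides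
  but one and satisfy the adjoint boundary condition on that side. Hence T* = S** is the closure
  of S, and it is enough to check that S is positive, which for smooth fields is Green's formula.

  That T* is contained in the closure of S is a projection argument in the space of pairs
  (\<Psi>, G) with square integrable entries: if (A, -B) is orthogonal to the graph of S then (B, A)
  belongs to the graph of T, and so (A, -B) is orthogonal to the graph of T*.
\<close>

section \<open>Square integrable functions on an arbitrary measure space\<close>

text \<open>Generalises \<open>in_L2\<close> to any measure and any Euclidean target space, because
  the graph argument uses pairs (\<Psi>, G) as single functions with values in a product
  space.\<close>

definition L2_fun :: "'a measure \<Rightarrow> ('a \<Rightarrow> 'b::euclidean_space) \<Rightarrow> bool" where
  "L2_fun M f \<longleftrightarrow> f \<in> borel_measurable M \<and> integrable M (\<lambda>x. (norm (f x))\<^sup>2)"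

lemma in_L2_iff_L2_fun: "in_L2 S f \<longleftrightarrow> L2_fun (lebesgue_on S) f"
  by (simp add: in_L2_def L2_fun_def)

lemma L2_fun_measurable: "L2_fun M f \<Longrightarrow> f \<in> borel_measurable M"
  by (simp add: L2_fun_def)

lemma L2_fun_integrable_sq: "L2_fun M f \<Longrightarrow> integrable M (\<lambda>x. (norm (f x))\<^sup>2)"
  by (simp add: L2_fun_def)

lemma abs_inner_le_sum_squares: "\<bar>x \<bullet> y\<bar> \<le> (norm x)\<^sup>2 + (norm (y::'b::real_inner))\<^sup>2"
proof -
  have "\<bar>x \<bullet> y\<bar> \<le> norm x * norm y"
    by (rule Cauchy_Schwarz_ineq2)
  moreover have "2 * (norm x * norm y) \<le> (norm x)\<^sup>2 + (norm y)\<^sup>2"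
    using sum_squares_bound[of "norm x" "norm y"] by simp
  moreover have "0 \<le> norm x * norm y"
    by simp
  ultimately show ?thesis
    by linarith
qed

lemma L2_fun_integrable_inner:
  assumes f: "L2_fun M f" and g: "L2_fun M g"
  shows "integrable M (\<lambda>x. f x \<bullet> g x)"
proof (rule Bochner_Integration.integrable_bound)
  show "integrable M (\<lambda>x. (norm (f x))\<^sup>2 + (norm (g x))\<^sup>2)"
    using assms by (simp add: L2_fun_def)
  show "(\<lambda>x. f x \<bullet> g x) \<in> borel_measurable M"
    using assms by (intro borel_measurable_inner L2_fun_measurable)
  show "AE x in M. norm (f x \<bullet> g x) \<le> norm ((norm (f x))\<^sup>2 + (norm (g x))\<^sup>2)"
    by (auto intro!: AE_I2 order_trans[OF abs_inner_le_sum_squares])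
qed

lemma L2_fun_add:
  assumes f: "L2_fun M f" and g: "L2_fun M g"
  shows "L2_fun M (\<lambda>x. f x + g x)"
proof -
  have "integrable M (\<lambda>x. (norm (f x))\<^sup>2 + 2 * (f x \<bullet> g x) + (norm (g x))\<^sup>2)"
    using f g L2_fun_integrable_inner[OF f g] by (simp add: L2_fun_def)
  then have "integrable M (\<lambda>x. (norm (f x + g x))\<^sup>2)"
    by (simp add: power2_norm_eq_inner inner_simps inner_commute algebra_simps)
  with assms show ?thesis
    by (auto simp: L2_fun_def)
qed

lemma L2_fun_minus: "L2_fun M f \<Longrightarrow> L2_fun M (\<lambda>x. - f x)"
  by (auto simp: L2_fun_def)

lemma L2_fun_diff:
  assumes "L2_fun M f" and "L2_fun M g"
  shows "L2_fun M (\<lambda>x. f x - g x)"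
  using L2_fun_add[OF assms(1) L2_fun_minus[OF assms(2)]] by simp

text \<open>This quadratic polynomial in t serves twice: its nonnegativity gives the Cauchy-Schwarz
  inequality, and its comparison with an infimum gives orthogonality in the projection
  argument.\<close>

lemma integral_norm_sq_diff_scaleR:
  assumes f: "L2_fun M f" and g: "L2_fun M g"
  shows "(LINT x|M. (norm (f x - t *\<^sub>R g x))\<^sup>2)
    = (LINT x|M. (norm (f x))\<^sup>2) - 2 * t * (LINT x|M. f x \<bullet> g x) + t\<^sup>2 * (LINT x|M. (norm (g x))\<^sup>2)"
proof -
  have "(norm (f x - t *\<^sub>R g x))\<^sup>2
      = (norm (f x))\<^sup>2 - 2 * t * (f x \<bullet> g x) + t\<^sup>2 * (norm (g x))\<^sup>2" for x
    by (simp only: power2_norm_eq_inner)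
       (simp add: inner_simps inner_commute algebra_simps power2_eq_square)
  then show ?thesis
    using f g L2_fun_integrable_inner[OF f g] by (simp add: L2_fun_def)
qed

lemma L2_Cauchy_Schwarz:
  assumes f: "L2_fun M f" and g: "L2_fun M g"
  shows "(LINT x|M. f x \<bullet> g x)\<^sup>2 \<le> (LINT x|M. (norm (f x))\<^sup>2) * (LINT x|M. (norm (g x))\<^sup>2)"
proof -
  define A B C where "A = (LINT x|M. (norm (f x))\<^sup>2)" and "B = (LINT x|M. f x \<bullet> g x)"
    and "C = (LINT x|M. (norm (g x))\<^sup>2)"
  have C: "C \<ge> 0"
    unfolding C_def by simp
  have q: "0 \<le> A - 2 * t * B + t\<^sup>2 * C" for t
    unfolding A_def B_def C_def using integral_norm_sq_diff_scaleR[OF f g, of t, symmetric] by simp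
  have "B\<^sup>2 \<le> A * C"
  proof (cases "C = 0")
    case True
    have "B = 0"
    proof (rule ccontr)
      assume "B \<noteq> 0"
      \<comment> \<open>When C = 0 the polynomial is A - 2 * t * B, which equals -1 at this
        t.\<close>
      with q[of "(A + 1) / (2 * B)"] True show False by simp
    qed
    with True show ?thesis by simp
  next
    case False
    then have "C > 0" using C by simp
    \<comment> \<open>B / C is the minimiser of the quadratic polynomial.\<close>
    with q[of "B / C"] show ?thesis
      by (simp add: field_simps power2_eq_square)
  qed
  then show ?thesis
    by (simp add: A_def B_def C_def)
qed

section \<open>Completeness of L^2 and orthogonal projection\<close>

lemma (in finite_measure) L2_fun_integrable:
  assumes "L2_fun M f"
  shows "integrable M f"
proof (rule Bochner_Integration.integrable_bound)
  show "integrable M (\<lambda>x. 1 + (norm (f x))\<^sup>2)"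
    using assms by (simp add: L2_fun_def)
  have "norm y \<le> 1 + (norm y)\<^sup>2" for y :: 'b
    using sum_squares_bound[of "norm y" 1] norm_ge_zero[of y] by (simp; linarith)
  then show "AE x in M. norm (f x) \<le> norm (1 + (norm (f x))\<^sup>2)"
    by simp
qed (use assms in \<open>simp add: L2_fun_def\<close>)

text \<open>Riesz-Fischer. Since the measure is finite, the sequence is also Cauchy in L^1, so a
  subsequence converges almost everywhere; Fatou's lemma then bounds the L^2 distance from each late
  term to that limit.\<close>

lemma (in finite_measure) L2_complete:
  fixes h :: "nat \<Rightarrow> 'a \<Rightarrow> 'b::euclidean_space"
  assumes L2: "\<And>n. L2_fun M (h n)"
    and Cauchy: "\<And>e. e > 0 \<Longrightarrow> \<exists>N. \<forall>i\<ge>N. \<forall>j\<ge>N. (LINT x|M. (norm (h i x - h j x))\<^sup>2) < e"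
  obtains g where "L2_fun M g" "(\<lambda>n. LINT x|M. (norm (h n x - g x))\<^sup>2) \<longlonglongrightarrow> 0"
proof -
  have [measurable]: "h n \<in> borel_measurable M" for n
    using L2 by (rule L2_fun_measurable)
  have L1: "\<exists>N. \<forall>i\<ge>N. \<forall>j\<ge>N. (LINT x|M. norm (h i x - h j x)) < e" if "e > 0" for e
  proof -
    define m where "m = measure M (space M) + 1"
    have m: "m > 0" unfolding m_def using measure_nonneg[of M "space M"] by linarith
    \<comment> \<open>Chosen for the bound \<open>r \<le> \<delta> + r\<^sup>2 / \<delta>\<close>:
      the constant contributes less than \<delta> * m = e / 2, and the square term less than e / 2
      once the squared L^2 distance is below \<delta> * (e / 2). The 1 added in m keeps it positive
      when the measure is zero.\<close>
    define \<delta> where "\<delta> = e / (2 * m)"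
    have \<delta>: "\<delta> > 0" using m that by (simp add: \<delta>_def)
    obtain N where N: "(LINT x|M. (norm (h i x - h j x))\<^sup>2) < \<delta> * (e / 2)"
      if "i \<ge> N" "j \<ge> N" for i j
      using Cauchy[of "\<delta> * (e / 2)"] \<delta> \<open>e > 0\<close> by auto
    have "(LINT x|M. norm (h i x - h j x)) < e" if "i \<ge> N" "j \<ge> N" for i j
    proof -
      have d: "L2_fun M (\<lambda>x. h i x - h j x)"
        by (intro L2_fun_diff L2)
      have le: "r \<le> \<delta> + r\<^sup>2 / \<delta>" if "r \<ge> 0" for r
      proof (cases "r \<le> \<delta>")
        case True
        have "0 \<le> r\<^sup>2 / \<delta>" using \<delta> by simp
        with True show ?thesis by linarith
      next
        case False
        then have "r * \<delta> \<le> r\<^sup>2" using \<delta> by (simp add: power2_eq_square)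
        then have "r \<le> r\<^sup>2 / \<delta>" using \<delta> by (simp add: field_simps)
        with \<delta> show ?thesis by linarith
      qed
      have "(LINT x|M. norm (h i x - h j x)) \<le> (LINT x|M. \<delta> + (norm (h i x - h j x))\<^sup>2 / \<delta>)"
        using d L2_fun_integrable[OF d] le by (intro integral_mono) (auto simp: L2_fun_def)
      also have "\<dots> = \<delta> * measure M (space M) + (LINT x|M. (norm (h i x - h j x))\<^sup>2) / \<delta>"
        using d by (simp add: L2_fun_def)
      also have "\<dots> < \<delta> * m + e / 2"
        using N[OF that] \<delta> by (intro add_strict_mono) (auto simp: m_def field_simps)
      also have "\<dots> = e"
        using m by (simp add: \<delta>_def)
      finally show ?thesis .
    qed
    then show ?thesis by blast
  qed
  obtain r where r: "strict_mono r" "AE x in M. Cauchy (\<lambda>i. h (r i) x)"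
    using cauchy_L1_AE_cauchy_subseq[OF L2_fun_integrable[OF L2] L1] by blast
  define g where "g x = lim (\<lambda>i. h (r i) x)" for x
  have [measurable]: "g \<in> borel_measurable M"
    unfolding g_def by measurable
  have lim: "AE x in M. (\<lambda>i. h (r i) x) \<longlonglongrightarrow> g x"
    using r(2) by eventually_elim (simp add: g_def Cauchy_convergent_iff convergent_LIMSEQ_iff)
  \<comment> \<open>The index n stays fixed while the other index runs to infinity along the
    subsequence.\<close>
  have Fatou: "(\<integral>\<^sup>+x. ennreal ((norm (h n x - g x))\<^sup>2) \<partial>M) \<le> ennreal e"
    if "e > 0" and N: "\<And>i j. i \<ge> N \<Longrightarrow> j \<ge> N \<Longrightarrow> (LINT x|M. (norm (h i x - h j x))\<^sup>2) < e"
      and "n \<ge> N" for n N e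
  proof -
    have "(\<integral>\<^sup>+x. ennreal ((norm (h n x - g x))\<^sup>2) \<partial>M)
        = (\<integral>\<^sup>+x. liminf (\<lambda>i. ennreal ((norm (h n x - h (r i) x))\<^sup>2)) \<partial>M)"
    proof (rule nn_integral_cong_AE)
      show "AE x in M. ennreal ((norm (h n x - g x))\<^sup>2)
          = liminf (\<lambda>i. ennreal ((norm (h n x - h (r i) x))\<^sup>2))"
        using lim
      proof eventually_elim
        case (elim x)
        then have "(\<lambda>i. ennreal ((norm (h n x - h (r i) x))\<^sup>2)) \<longlonglongrightarrow> ennreal ((norm (h n x - g x))\<^sup>2)"
          by (intro tendsto_ennrealI tendsto_intros)
        then show ?case
          by (intro lim_imp_Liminf[symmetric]) simp_all
      qed
    qed
    also have "\<dots> \<le> liminf (\<lambda>i. \<integral>\<^sup>+x. ennreal ((norm (h n x - h (r i) x))\<^sup>2) \<partial>M)"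
      by (intro nn_integral_liminf) measurable
    also have "\<dots> \<le> limsup (\<lambda>i. \<integral>\<^sup>+x. ennreal ((norm (h n x - h (r i) x))\<^sup>2) \<partial>M)"
      by (intro Liminf_le_Limsup) simp
    also have "\<dots> \<le> ennreal e"
    proof (intro Limsup_bounded)
      show "\<forall>\<^sub>F i in sequentially. (\<integral>\<^sup>+x. ennreal ((norm (h n x - h (r i) x))\<^sup>2) \<partial>M) \<le> ennreal e"
        using eventually_ge_at_top[of N]
      proof eventually_elim
        case (elim i)
        then have "r i \<ge> N"
          using seq_suble[OF r(1), of i] by linarith
        moreover have "L2_fun M (\<lambda>x. h n x - h (r i) x)"
          by (intro L2_fun_diff L2)
        ultimately show ?case
          using N[OF \<open>n \<ge> N\<close>, of "r i"]
          by (subst nn_integral_eq_integral) (auto simp: L2_fun_def intro!: ennreal_leI)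
      qed
    qed
    finally show ?thesis .
  qed
  have hg: "L2_fun M (\<lambda>x. h n x - g x) \<and> (LINT x|M. (norm (h n x - g x))\<^sup>2) \<le> e"
    if "e > 0" and "\<And>i j. i \<ge> N \<Longrightarrow> j \<ge> N \<Longrightarrow> (LINT x|M. (norm (h i x - h j x))\<^sup>2) < e"
      and "n \<ge> N" for n N e
  proof -
    note F = Fatou[OF that]
    have int: "integrable M (\<lambda>x. (norm (h n x - g x))\<^sup>2)"
      using F by (intro integrableI_bounded) (auto intro: le_less_trans)
    moreover have "ennreal (LINT x|M. (norm (h n x - g x))\<^sup>2) \<le> ennreal e"
      using F by (subst nn_integral_eq_integral[symmetric, OF int]) auto
    ultimately show ?thesis
      using \<open>e > 0\<close> by (simp add: L2_fun_def)
  qed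
  obtain N1 where "\<And>i j. i \<ge> N1 \<Longrightarrow> j \<ge> N1 \<Longrightarrow> (LINT x|M. (norm (h i x - h j x))\<^sup>2) < 1"
    using Cauchy[of 1] by auto
  then have "L2_fun M (\<lambda>x. h N1 x - g x)"
    using hg[of 1 N1 N1] by auto
  from L2_fun_diff[OF L2[of N1] this] have "L2_fun M g"
    by simp
  moreover have "(\<lambda>n. LINT x|M. (norm (h n x - g x))\<^sup>2) \<longlonglongrightarrow> 0"
  proof (rule LIMSEQ_I)
    fix e :: real assume "e > 0"
    then obtain N where "\<And>i j. i \<ge> N \<Longrightarrow> j \<ge> N \<Longrightarrow> (LINT x|M. (norm (h i x - h j x))\<^sup>2) < e / 2"
      using Cauchy[of "e / 2"] by auto
    then have "(LINT x|M. (norm (h n x - g x))\<^sup>2) \<le> e / 2" if "n \<ge> N" for n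
      using hg[of "e / 2" N n] that \<open>e > 0\<close> by auto
    then show "\<exists>N. \<forall>n\<ge>N. norm ((LINT x|M. (norm (h n x - g x))\<^sup>2) - 0) < e"
      using \<open>e > 0\<close> by (intro exI[of _ N]) (force simp: intro: le_less_trans[of _ "e / 2"])
  qed
  ultimately show ?thesis
    by (rule that)
qed

text \<open>The double orthogonal complement of a subspace is its closure: \<open>orth\<close>
  places f in the double complement of D. The residuals of a minimising sequence converge to some e
  orthogonal to D, hence to f, and this forces e = 0 almost everywhere.\<close>

lemma (in finite_measure) L2_approximable_if_orthogonal:
  fixes f :: "'a \<Rightarrow> 'b::euclidean_space"
  assumes f: "L2_fun M f"
    and D: "\<And>d. d \<in> D \<Longrightarrow> L2_fun M d" and "D \<noteq> {}"
    and lin: "\<And>c d s t. c \<in> D \<Longrightarrow> d \<in> D \<Longrightarrow> (\<lambda>x. s *\<^sub>R c x + t *\<^sub>R d x) \<in> D"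
    and orth: "\<And>e. L2_fun M e \<Longrightarrow> (\<And>d. d \<in> D \<Longrightarrow> (LINT x|M. e x \<bullet> d x) = 0)
        \<Longrightarrow> (LINT x|M. e x \<bullet> f x) = 0"
  obtains d where "\<And>n::nat. d n \<in> D" "(\<lambda>n. LINT x|M. (norm (f x - d n x))\<^sup>2) \<longlonglongrightarrow> 0"
proof -
  define J where "J d = (LINT x|M. (norm (f x - d x))\<^sup>2)" for d
  define m where "m = Inf (J ` D)"
  have bdd: "bdd_below (J ` D)"
    by (rule bdd_belowI[of _ 0]) (auto simp: J_def)
  have m: "m \<le> J d" if "d \<in> D" for d
    unfolding m_def using that bdd by (intro cInf_lower) auto
  have "\<exists>d\<in>D. J d < m + 1 / real (Suc n)" for n
    using cInf_lessD[of "J ` D" "m + 1 / real (Suc n)"] \<open>D \<noteq> {}\<close> by (auto simp: m_def)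
  then obtain d where d: "d n \<in> D" and Jd: "J (d n) < m + 1 / real (Suc n)" for n
    by metis
  define h where "h n x = f x - d n x" for n x
  have h: "L2_fun M (h n)" for n
    unfolding h_def by (intro L2_fun_diff f D d)
  have Jh: "J (d n) = (LINT x|M. (norm (h n x))\<^sup>2)" for n
    by (simp add: J_def h_def)
  \<comment> \<open>The midpoint c of the two approximants lies in D, so its squared distance to f
    is at least m. In the parallelogram law this cancels the two copies of 2 * m coming from
    near-minimality.\<close>
  have parallelogram: "(LINT x|M. (norm (h i x - h j x))\<^sup>2) \<le> 2 / real (Suc i) + 2 / real (Suc j)" for i j
  proof -
    define c where "c x = (1/2) *\<^sub>R d i x + (1/2) *\<^sub>R d j x" for x
    have c: "c \<in> D"
      unfolding c_def by (intro lin d)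
    have fc: "L2_fun M (\<lambda>x. f x - c x)"
      by (intro L2_fun_diff f D c)
    have *: "(norm (h i x - h j x))\<^sup>2
        = 2 * (norm (h i x))\<^sup>2 + 2 * (norm (h j x))\<^sup>2 - 4 * (norm (f x - c x))\<^sup>2" for x
    proof -
      have "f x - c x = (1/2) *\<^sub>R (h i x + h j x)"
        by (simp add: h_def c_def algebra_simps flip: scaleR_left.add)
      then show ?thesis
        by (simp only: power2_norm_eq_inner) (simp add: inner_simps inner_commute algebra_simps)
    qed
    have "(LINT x|M. (norm (h i x - h j x))\<^sup>2) = 2 * J (d i) + 2 * J (d j) - 4 * J c"
      unfolding * Jh using h[of i] h[of j] fc by (simp add: L2_fun_def J_def)
    then show ?thesis
      using m[OF c] Jd[of i] Jd[of j] by simp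
  qed
  have "\<exists>N. \<forall>i\<ge>N. \<forall>j\<ge>N. (LINT x|M. (norm (h i x - h j x))\<^sup>2) < \<epsilon>" if "\<epsilon> > 0" for \<epsilon>
  proof -
    have "\<epsilon> / 4 > 0"
      using that by simp
    then obtain N where N: "1 / real (Suc N) < \<epsilon> / 4"
      by (rule nat_approx_posE)
    have "2 / real (Suc i) < \<epsilon> / 2" if "i \<ge> N" for i
    proof -
      have "1 / real (Suc i) \<le> 1 / real (Suc N)"
        using that by (intro divide_left_mono) auto
      with N show ?thesis by simp
    qed
    then have "(LINT x|M. (norm (h i x - h j x))\<^sup>2) < \<epsilon>" if "i \<ge> N" "j \<ge> N" for i j
      using parallelogram[of i j] that by (smt (verit) field_sum_of_halves)
    then show ?thesis by blast
  qed
  from L2_complete[OF h this] obtain e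
    where e: "L2_fun M e" and he: "(\<lambda>n. LINT x|M. (norm (h n x - e x))\<^sup>2) \<longlonglongrightarrow> 0"
    by blast
  \<comment> \<open>By Cauchy-Schwarz, L^2 convergence implies convergence of the pairings with a
    fixed g.\<close>
  have weak: "(\<lambda>n. LINT x|M. h n x \<bullet> g x) \<longlonglongrightarrow> (LINT x|M. e x \<bullet> g x)" if g: "L2_fun M g" for g
  proof -
    have hen: "L2_fun M (\<lambda>x. h n x - e x)" for n
      by (intro L2_fun_diff h e)
    have bound: "(\<lambda>n. (LINT x|M. (norm (h n x - e x))\<^sup>2) * (LINT x|M. (norm (g x))\<^sup>2)) \<longlonglongrightarrow> 0"
      using he by (rule tendsto_mult_left_zero)
    have "(\<lambda>n. (LINT x|M. (h n x - e x) \<bullet> g x)\<^sup>2) \<longlonglongrightarrow> 0"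
      by (rule tendsto_sandwich[OF _ _ tendsto_const bound])
         (simp_all add: L2_Cauchy_Schwarz[OF hen g])
    then have "(\<lambda>n. (LINT x|M. (h n x - e x) \<bullet> g x)) \<longlonglongrightarrow> 0"
      using tendsto_real_sqrt[of "\<lambda>n. (LINT x|M. (h n x - e x) \<bullet> g x)\<^sup>2" 0 sequentially]
      by (simp add: tendsto_rabs_zero_iff)
    moreover have "(LINT x|M. (h n x - e x) \<bullet> g x) = (LINT x|M. h n x \<bullet> g x) - (LINT x|M. e x \<bullet> g x)" for n
      by (simp add: inner_diff_left L2_fun_integrable_inner h e g)
    ultimately show ?thesis
      by (simp add: LIM_zero_iff)
  qed
  have eD: "(LINT x|M. e x \<bullet> c x) = 0" if c: "c \<in> D" for c
  proof -
    define C where "C = (LINT x|M. (norm (c x))\<^sup>2)"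
    define B where "B = (LINT x|M. e x \<bullet> c x)"
    \<comment> \<open>First variation: moving \<open>d n\<close> to \<open>d n\<close> + t * c
      inside D cannot push the squared distance below m, and \<open>J (d n)\<close> exceeds m by
      less than 1 / (n + 1). Letting n grow leaves an inequality for the limit e.\<close>
    have q: "2 * t * B \<le> t\<^sup>2 * C" for t
    proof -
      have "2 * t * (LINT x|M. h n x \<bullet> c x) \<le> t\<^sup>2 * C + 1 / real (Suc n)" for n
      proof -
        have "(\<lambda>x. 1 *\<^sub>R d n x + t *\<^sub>R c x) \<in> D"
          by (intro lin d c)
        from m[OF this] have "m \<le> (LINT x|M. (norm (h n x - t *\<^sub>R c x))\<^sup>2)"
          by (simp add: J_def h_def algebra_simps)
        then show ?thesis
          using Jd[of n] unfolding Jh integral_norm_sq_diff_scaleR[OF h D[OF c]] C_def by simp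
      qed
      moreover have "(\<lambda>n. t\<^sup>2 * C + 1 / real (Suc n)) \<longlonglongrightarrow> t\<^sup>2 * C + 0"
        using LIMSEQ_inverse_real_of_nat by (intro tendsto_intros) (simp add: inverse_eq_divide)
      moreover have "(\<lambda>n. 2 * t * (LINT x|M. h n x \<bullet> c x)) \<longlonglongrightarrow> 2 * t * B"
        unfolding B_def by (intro tendsto_intros weak D c)
      ultimately show ?thesis
        by (intro LIMSEQ_le[of _ _ "\<lambda>n. t\<^sup>2 * C + 1 / real (Suc n)"]) auto
    qed
    have C: "C \<ge> 0" by (simp add: C_def)
    \<comment> \<open>Close to the optimal B / C, with C + 1 as denominator so that C = 0 is covered
      too.\<close>
    define t where "t = B / (C + 1)"
    have B: "B = t * (C + 1)"
      using C by (simp add: t_def)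
    have "t\<^sup>2 * (C + 2) \<le> 0"
      using q[of t] by (simp add: B algebra_simps power2_eq_square)
    with C have "t = 0"
      by (simp add: mult_le_0_iff)
    with B have "B = 0"
      by simp
    then show ?thesis by (simp add: B_def)
  qed
  have "(LINT x|M. e x \<bullet> f x) = 0"
    using e eD by (rule orth)
  \<comment> \<open>Each residual is f minus an element of D, and e is orthogonal to both.\<close>
  then have "(LINT x|M. h n x \<bullet> e x) = 0" for n
    using eD[OF d[of n]] L2_fun_integrable_inner[OF e f] L2_fun_integrable_inner[OF e D[OF d[of n]]]
    by (simp add: h_def inner_diff_right inner_commute[of _ "e _"])
  with weak[OF e] have ee: "(LINT x|M. (norm (e x))\<^sup>2) = 0"
    by (simp add: LIMSEQ_const_iff power2_norm_eq_inner)
  have ae: "AE x in M. e x = 0"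
    using integral_nonneg_eq_0_iff_AE[THEN iffD1, OF L2_fun_integrable_sq[OF e] _ ee] by auto
  have "(LINT x|M. (norm (h n x - e x))\<^sup>2) = (LINT x|M. (norm (f x - d n x))\<^sup>2)" for n
    using h[of n] e L2_fun_diff[OF h[of n] e] ae
    by (intro integral_cong_AE) (auto simp: h_def L2_fun_def)
  with he d show ?thesis
    by (intro that) auto
qed

section \<open>Smooth fields and their linear combinations\<close>

lemma smooth2_differentiable: "smooth2 f \<Longrightarrow> f differentiable (at p)"
  by (erule smooth2.cases) blast

lemma smooth2_dx: "smooth2 f \<Longrightarrow> smooth2 (dx f)"
  by (erule smooth2.cases) blast

lemma smooth2_dy: "smooth2 f \<Longrightarrow> smooth2 (dy f)"
  by (erule smooth2.cases) blast

lemma smooth2_continuous_on: "smooth2 f \<Longrightarrow> continuous_on S f"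
  by (meson continuous_at_imp_continuous_on differentiable_imp_continuous_within smooth2_differentiable)

lemma frechet_derivative_lincomb:
  assumes "f differentiable (at p)" and "g differentiable (at p)"
  shows "frechet_derivative (\<lambda>p. s *\<^sub>R f p + t *\<^sub>R g p) (at p)
    = (\<lambda>v. s *\<^sub>R frechet_derivative f (at p) v + t *\<^sub>R frechet_derivative g (at p) v)"
  using assms unfolding frechet_derivative_works
  by (intro frechet_derivative_at[symmetric] has_derivative_add has_derivative_scaleR_right)

lemma
  assumes "smooth2 f" and "smooth2 g"
  shows dx_lincomb: "dx (\<lambda>p. s *\<^sub>R f p + t *\<^sub>R g p) = (\<lambda>p. s *\<^sub>R dx f p + t *\<^sub>R dx g p)"
    and dy_lincomb: "dy (\<lambda>p. s *\<^sub>R f p + t *\<^sub>R g p) = (\<lambda>p. s *\<^sub>R dy f p + t *\<^sub>R dy g p)"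
  by (simp_all add: fun_eq_iff dx_def dy_def assms smooth2_differentiable frechet_derivative_lincomb)

text \<open>Coinduction on the set of all combinations with the same coefficients s and t, which is
  closed under both partial derivatives because derivatives of smooth fields are smooth.\<close>

lemma smooth2_lincomb:
  assumes "smooth2 f" and "smooth2 g"
  shows "smooth2 (\<lambda>p. s *\<^sub>R f p + t *\<^sub>R g p)"
proof (rule smooth2.coinduct[of
      "\<lambda>h. \<exists>f g. smooth2 f \<and> smooth2 g \<and> h = (\<lambda>p. s *\<^sub>R f p + t *\<^sub>R g p)"])
  show "\<exists>f' g'. smooth2 f' \<and> smooth2 g'
      \<and> (\<lambda>p. s *\<^sub>R f p + t *\<^sub>R g p) = (\<lambda>p. s *\<^sub>R f' p + t *\<^sub>R g' p)"
    using assms by blast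
next
  fix h assume "\<exists>f g. smooth2 f \<and> smooth2 g \<and> h = (\<lambda>p. s *\<^sub>R f p + t *\<^sub>R g p)"
  then obtain f g where fg: "smooth2 f" "smooth2 g" and h: "h = (\<lambda>p. s *\<^sub>R f p + t *\<^sub>R g p)"
    by blast
  have "h differentiable (at p)" for p
    unfolding h by (intro differentiable_add differentiable_scaleR differentiable_const smooth2_differentiable fg)
  moreover have "dx h = (\<lambda>p. s *\<^sub>R dx f p + t *\<^sub>R dx g p)"
      "dy h = (\<lambda>p. s *\<^sub>R dy f p + t *\<^sub>R dy g p)"
    unfolding h using fg by (rule dx_lincomb dy_lincomb)+
  ultimately show "\<exists>h'. h = h' \<and> (\<forall>p. h' differentiable (at p))
      \<and> ((\<exists>f g. smooth2 f \<and> smooth2 g \<and> dx h' = (\<lambda>p. s *\<^sub>R f p + t *\<^sub>R g p)) \<or> smooth2 (dx h'))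
      \<and> ((\<exists>f g. smooth2 f \<and> smooth2 g \<and> dy h' = (\<lambda>p. s *\<^sub>R f p + t *\<^sub>R g p)) \<or> smooth2 (dy h'))"
    using fg smooth2_dx smooth2_dy by metis
qed

lemma smooth2_zero: "smooth2 (\<lambda>p. 0)"
proof (coinduction rule: smooth2.coinduct)
  case smooth2
  have "dx (\<lambda>p. 0) = (\<lambda>p. 0)" "dy (\<lambda>p. 0) = (\<lambda>p. 0)"
    by (simp_all add: dx_def dy_def fun_eq_iff frechet_derivative_const)
  then show ?case by simp
qed

section \<open>The symmetric coefficient matrices and their quadratic forms\<close>

lemma bounded_linear_Tmat: "bounded_linear (Tmat a b)"
  unfolding linear_conv_bounded_linear[symmetric]
  by (rule linearI) (auto simp: Tmat_def algebra_simps)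

lemma Tmat_zero [simp]: "Tmat a b 0 = 0"
  by (simp add: Tmat_def zero_prod_def)

lemma Tmat_lincomb: "Tmat a b (s *\<^sub>R u + t *\<^sub>R v) = s *\<^sub>R Tmat a b u + t *\<^sub>R Tmat a b v"
  by (simp add: Tmat_def algebra_simps)

lemma Tmat_inner_commute: "Tmat a b u \<bullet> v = Tmat a b v \<bullet> u"
  by (simp add: Tmat_def inner_prod_def algebra_simps)

text \<open>The condition reads b * \<open>fst v\<close> = a * \<open>snd v\<close>; multiplying the
  form by a > 0 and eliminating \<open>snd v\<close> leaves a multiple of the square of
  \<open>fst v\<close>.\<close>

lemma Tmat_quadratic_nonneg:
  assumes "a > 0" and "snd (Tmat a b v) = 0"
  shows "Tmat a b v \<bullet> v \<ge> 0"
proof -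
  have "a * (Tmat a b v \<bullet> v) = (a\<^sup>2 + b\<^sup>2) * (fst v)\<^sup>2"
    using assms(2) by (simp add: Tmat_def inner_prod_def) algebra
  then show ?thesis
    using assms(1) by (metis mult_nonneg_nonneg sum_power2_ge_zero zero_le_mult_iff zero_le_power2 not_less)
qed

text \<open>Here \<open>fst v\<close> is eliminated instead, and the lower right entry -a of the
  matrix reverses the sign.\<close>

lemma Tmat_quadratic_nonpos:
  assumes "a > 0" and "fst (Tmat a b v) = 0"
  shows "Tmat a b v \<bullet> v \<le> 0"
proof -
  have "a * (Tmat a b v \<bullet> v) = - ((a\<^sup>2 + b\<^sup>2) * (snd v)\<^sup>2)"
    using assms(2) by (simp add: Tmat_def inner_prod_def) algebra
  also have "\<dots> \<le> 0" by simp
  finally show ?thesis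
    using assms(1) by (simp add: mult_le_0_iff)
qed

section \<open>Differentiation along the axes and integration over the rectangle\<close>

lemma
  assumes "smooth2 f"
  shows has_vector_derivative_dx: "((\<lambda>x. f (x, y)) has_vector_derivative dx f (x, y)) (at x within S)"
    and has_vector_derivative_dy: "((\<lambda>y. f (x, y)) has_vector_derivative dy f (x, y)) (at y within S')"
proof -
  let ?D = "frechet_derivative f (at (x, y))"
  have D: "(f has_derivative ?D) (at (x, y))"
    using smooth2_differentiable[OF assms] by (simp add: frechet_derivative_works)
  then have lin: "linear ?D"
    by (rule has_derivative_linear)
  have "((\<lambda>x. (x, y)) has_derivative (\<lambda>h. (h, 0))) (at x within S)"
    by (intro has_derivative_Pair has_derivative_ident has_derivative_const)
  from has_derivative_compose[OF this D]
  show "((\<lambda>x. f (x, y)) has_vector_derivative dx f (x, y)) (at x within S)"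
    unfolding has_vector_derivative_def dx_def
    by (simp add: linear_cmul[OF lin, symmetric])
  have "((\<lambda>y. (x, y)) has_derivative (\<lambda>h. (0, h))) (at y within S')"
    by (intro has_derivative_Pair has_derivative_ident has_derivative_const)
  from has_derivative_compose[OF this D]
  show "((\<lambda>y. f (x, y)) has_vector_derivative dy f (x, y)) (at y within S')"
    unfolding has_vector_derivative_def dy_def
    by (simp add: linear_cmul[OF lin, symmetric])
qed

text \<open>By symmetry of the matrix the integrand is half the derivative of the quadratic form
  along f.\<close>

lemma integral_Tmat_inner_derivative:
  assumes f: "\<And>x. x \<in> {0..L} \<Longrightarrow> (f has_vector_derivative f' x) (at x within {0..L})" and "0 \<le> L"
  shows "integral {0..L} (\<lambda>x. Tmat a b (f' x) \<bullet> f x)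
    = (Tmat a b (f L) \<bullet> f L - Tmat a b (f 0) \<bullet> f 0) / 2"
proof -
  have "((\<lambda>x. (Tmat a b (f x) \<bullet> f x) / 2) has_vector_derivative Tmat a b (f' x) \<bullet> f x) (at x within {0..L})"
    if "x \<in> {0..L}" for x
  proof -
    have "((\<lambda>x. Tmat a b (f x) \<bullet> f x) has_vector_derivative
        (Tmat a b (f x) \<bullet> f' x + Tmat a b (f' x) \<bullet> f x)) (at x within {0..L})"
      by (intro bounded_bilinear.has_vector_derivative[OF bounded_bilinear_inner]
          bounded_linear.has_vector_derivative[OF bounded_linear_Tmat] f that)
    from has_vector_derivative_scaleR[OF DERIV_const this, of "1/2"] show ?thesis
      by (simp add: Tmat_inner_commute[of a b "f x" "f' x"])
  qed
  from fundamental_theorem_of_calculus[OF \<open>0 \<le> L\<close> this]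
  show ?thesis
    by (simp add: integral_unique diff_divide_distrib)
qed

text \<open>The boundary conditions hold on open sides only, so the sign of a boundary integrand is
  not given at the corners; these form a null set.\<close>

lemma integral_nonpos_interior:
  fixes k :: "real \<Rightarrow> real"
  assumes "continuous_on {0..L} k" and "\<And>y. y \<in> {0<..<L} \<Longrightarrow> k y \<le> 0"
  shows "integral {0..L} k \<le> 0"
proof -
  have "k integrable_on {0<..<L}"
    unfolding integrable_on_open_interval_real
    using assms(1) by (rule integrable_continuous_interval)
  from integral_le[OF this integrable_0] assms(2)
  show ?thesis by (simp add: integral_open_interval_real)
qed

lemma Omega_eq_box: "Omega L1 L2 = box (0, 0) (L1, L2)"
  by (force simp: Omega_def box_def Basis_prod_def)

lemma Omega_lebesgue [measurable, simp]: "Omega L1 L2 \<in> sets lebesgue"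
  by (simp add: Omega_eq_box)

lemma continuous_integrable_Omega:
  fixes g :: "real \<times> real \<Rightarrow> 'b::euclidean_space"
  assumes "continuous_on UNIV g"
  shows "integrable (lebesgue_on (Omega L1 L2)) g"
proof -
  have "set_integrable lebesgue (cbox (0, 0) (L1, L2)) g"
    using continuous_on_subset[OF assms] by (intro absolutely_integrable_continuous) auto
  then have "set_integrable lebesgue (Omega L1 L2) g"
    by (rule set_integrable_subset) (auto simp: Omega_eq_box box_subset_cbox)
  then show ?thesis
    by (simp add: integrable_restrict_space set_integrable_def)
qed

text \<open>Both orders of integration are provided because each term of Green's formula is
  integrated first along its own direction of differentiation.\<close>

lemma continuous_integral_Omega:
  fixes g :: "real \<times> real \<Rightarrow> real"
  assumes "continuous_on UNIV g"
  shows "(LINT p|lebesgue_on (Omega L1 L2). g p) = integral {0..L1} (\<lambda>x. integral {0..L2} (\<lambda>y. g (x, y)))"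
    and "(LINT p|lebesgue_on (Omega L1 L2). g p) = integral {0..L2} (\<lambda>y. integral {0..L1} (\<lambda>x. g (x, y)))"
proof -
  have g: "continuous_on S g" for S
    using assms by (rule continuous_on_subset) auto
  have "(LINT p|lebesgue_on (Omega L1 L2). g p) = integral (cbox (0, 0) (L1, L2)) g"
    using lebesgue_integral_eq_integral[OF continuous_integrable_Omega[OF assms] Omega_lebesgue]
    by (simp add: Omega_eq_box integral_open_interval)
  also have "\<dots> = integral {0..L1} (\<lambda>x. integral {0..L2} (\<lambda>y. g (x, y)))"
    using integral_prod_continuous[OF g, of 0 0 L1 L2] by simp
  finally show *: "(LINT p|lebesgue_on (Omega L1 L2). g p) = integral {0..L1} (\<lambda>x. integral {0..L2} (\<lambda>y. g (x, y)))" .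
  show "(LINT p|lebesgue_on (Omega L1 L2). g p) = integral {0..L2} (\<lambda>y. integral {0..L1} (\<lambda>x. g (x, y)))"
    unfolding * using integral_swap_continuous[of 0 0 L1 L2 "\<lambda>x y. g (x, y)"] g by simp
qed

section \<open>The formal operator, Green's formula and the core of the adjoint\<close>

text \<open>The expression paired with \<Theta> in \<open>green\<close>; the operator S is its
  negative.\<close>

definition formal_T :: "real \<Rightarrow> real \<Rightarrow> real \<Rightarrow> real
    \<Rightarrow> (real \<times> real \<Rightarrow> real \<times> real) \<Rightarrow> real \<times> real \<Rightarrow> real \<times> real" where
  "formal_T a1 b1 a2 b2 \<Phi> = (\<lambda>p. Tmat a1 b1 (dx \<Phi> p) + Tmat a2 b2 (dy \<Phi> p))"

lemma continuous_on_Tmat [continuous_intros]: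
  "continuous_on S f \<Longrightarrow> continuous_on S (\<lambda>x. Tmat a b (f x))"
  by (rule bounded_linear.continuous_on[OF bounded_linear_Tmat])

text \<open>Integration by parts leaves only boundary terms. East and north terms enter with a plus
  sign and a nonpositive form, west and south terms with a minus sign and a nonnegative
  form.\<close>

lemma formal_T_dissipative:
  assumes f: "smooth2 f" and "a1 > 0" "a2 > 0" "L1 \<ge> 0" "L2 \<ge> 0"
    and W: "\<And>y. y \<in> {0<..<L2} \<Longrightarrow> snd (Tmat a1 b1 (f (0, y))) = 0"
    and E: "\<And>y. y \<in> {0<..<L2} \<Longrightarrow> fst (Tmat a1 b1 (f (L1, y))) = 0"
    and S: "\<And>x. x \<in> {0<..<L1} \<Longrightarrow> snd (Tmat a2 b2 (f (x, 0))) = 0"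
    and N: "\<And>x. x \<in> {0<..<L1} \<Longrightarrow> fst (Tmat a2 b2 (f (x, L2))) = 0"
  shows "L2_inner (Omega L1 L2) (formal_T a1 b1 a2 b2 f) f \<le> 0"
proof -
  let ?M = "lebesgue_on (Omega L1 L2)"
  note cont = smooth2_continuous_on[OF f] smooth2_continuous_on[OF smooth2_dx[OF f]]
    smooth2_continuous_on[OF smooth2_dy[OF f]]
  have line: "continuous_on A (\<lambda>y. f (x, y))" "continuous_on A (\<lambda>x. f (x, y))" for A x y
    by (rule continuous_on_compose2[OF cont(1)[of UNIV]]; auto intro!: continuous_intros)+
  have c1: "continuous_on UNIV (\<lambda>p. Tmat a1 b1 (dx f p) \<bullet> f p)"
    and c2: "continuous_on UNIV (\<lambda>p. Tmat a2 b2 (dy f p) \<bullet> f p)"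
    by (intro continuous_intros cont)+
  have "(LINT p|?M. Tmat a1 b1 (dx f p) \<bullet> f p)
      = integral {0..L2} (\<lambda>y. (Tmat a1 b1 (f (L1, y)) \<bullet> f (L1, y) - Tmat a1 b1 (f (0, y)) \<bullet> f (0, y)) / 2)"
    unfolding continuous_integral_Omega(2)[OF c1]
    by (subst integral_Tmat_inner_derivative[OF has_vector_derivative_dx[OF f] \<open>L1 \<ge> 0\<close>]) simp
  also have "\<dots> \<le> 0"
    using Tmat_quadratic_nonneg[OF \<open>a1 > 0\<close> W] Tmat_quadratic_nonpos[OF \<open>a1 > 0\<close> E]
    by (intro integral_nonpos_interior continuous_intros line) (auto, force)
  finally have x: "(LINT p|?M. Tmat a1 b1 (dx f p) \<bullet> f p) \<le> 0" .
  have "(LINT p|?M. Tmat a2 b2 (dy f p) \<bullet> f p)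
      = integral {0..L1} (\<lambda>x. (Tmat a2 b2 (f (x, L2)) \<bullet> f (x, L2) - Tmat a2 b2 (f (x, 0)) \<bullet> f (x, 0)) / 2)"
    unfolding continuous_integral_Omega(1)[OF c2]
    by (subst integral_Tmat_inner_derivative[OF has_vector_derivative_dy[OF f] \<open>L2 \<ge> 0\<close>]) simp
  also have "\<dots> \<le> 0"
    using Tmat_quadratic_nonneg[OF \<open>a2 > 0\<close> S] Tmat_quadratic_nonpos[OF \<open>a2 > 0\<close> N]
    by (intro integral_nonpos_interior continuous_intros line) (auto, force)
  finally have y: "(LINT p|?M. Tmat a2 b2 (dy f p) \<bullet> f p) \<le> 0" .
  show ?thesis
    using x y continuous_integrable_Omega[OF c1] continuous_integrable_Omega[OF c2]
    by (simp add: formal_T_def L2_inner_def inner_add_left)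
qed

text \<open>The domain of S: the boundary conditions are those under which the boundary terms of Green's
  formula vanish against \<open>\<theta>\<^sub>1 = 0\<close> on the west and south sides and \<open>\<theta>\<^sub>2 = 0\<close> on the east and north.\<close>
inductive adjoint_core :: "real \<Rightarrow> real \<Rightarrow> real \<Rightarrow> real \<Rightarrow> real \<Rightarrow> real
    \<Rightarrow> (real \<times> real \<Rightarrow> real \<times> real) \<Rightarrow> bool"
  for L1 L2 a1 b1 a2 b2 where
  W: "side_test L1 L2 ({0..<L1} \<times> {0<..<L2}) \<Phi>
      \<Longrightarrow> (\<And>y. y \<in> {0<..<L2} \<Longrightarrow> snd (Tmat a1 b1 (\<Phi> (0, y))) = 0)
      \<Longrightarrow> adjoint_core L1 L2 a1 b1 a2 b2 \<Phi>"
| S: "side_test L1 L2 ({0<..<L1} \<times> {0..<L2}) \<Phi>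
      \<Longrightarrow> (\<And>x. x \<in> {0<..<L1} \<Longrightarrow> snd (Tmat a2 b2 (\<Phi> (x, 0))) = 0)
      \<Longrightarrow> adjoint_core L1 L2 a1 b1 a2 b2 \<Phi>"
| E: "side_test L1 L2 ({0<..L1} \<times> {0<..<L2}) \<Phi>
      \<Longrightarrow> (\<And>y. y \<in> {0<..<L2} \<Longrightarrow> fst (Tmat a1 b1 (\<Phi> (L1, y))) = 0)
      \<Longrightarrow> adjoint_core L1 L2 a1 b1 a2 b2 \<Phi>"
| N: "side_test L1 L2 ({0<..<L1} \<times> {0<..L2}) \<Phi>
      \<Longrightarrow> (\<And>x. x \<in> {0<..<L1} \<Longrightarrow> fst (Tmat a2 b2 (\<Phi> (x, L2))) = 0)
      \<Longrightarrow> adjoint_core L1 L2 a1 b1 a2 b2 \<Phi>"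
| lincomb: "adjoint_core L1 L2 a1 b1 a2 b2 \<Phi> \<Longrightarrow> adjoint_core L1 L2 a1 b1 a2 b2 \<Xi>
      \<Longrightarrow> adjoint_core L1 L2 a1 b1 a2 b2 (\<lambda>p. s *\<^sub>R \<Phi> p + t *\<^sub>R \<Xi> p)"

lemma side_test_eq_0:
  assumes "side_test L1 L2 U \<Phi>" "p \<in> {0..L1} \<times> {0..L2}" "p \<notin> U"
  shows "\<Phi> p = 0"
  using assms closure_subset[of "{p. \<Phi> p \<noteq> 0}"] by (auto simp: side_test_def)

lemma adjoint_core_zero: "adjoint_core L1 L2 a1 b1 a2 b2 (\<lambda>p. 0)"
  by (rule adjoint_core.W) (simp_all add: side_test_def smooth2_zero)

lemma adjoint_core_smooth2: "adjoint_core L1 L2 a1 b1 a2 b2 \<Phi> \<Longrightarrow> smooth2 \<Phi>"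
  by (induction rule: adjoint_core.induct) (simp_all add: side_test_def smooth2_lincomb)

text \<open>A generator satisfies the condition of its own side by definition and vanishes on the
  other three sides. The four conditions are linear, so they pass to the span.\<close>

lemma adjoint_core_boundary:
  assumes "adjoint_core L1 L2 a1 b1 a2 b2 \<Phi>" and "0 < L1" and "0 < L2"
  shows "(\<forall>y\<in>{0<..<L2}. snd (Tmat a1 b1 (\<Phi> (0, y))) = 0 \<and> fst (Tmat a1 b1 (\<Phi> (L1, y))) = 0)
    \<and> (\<forall>x\<in>{0<..<L1}. snd (Tmat a2 b2 (\<Phi> (x, 0))) = 0 \<and> fst (Tmat a2 b2 (\<Phi> (x, L2))) = 0)"
  using assms
proof induction
  case (W \<Phi>)
  then show ?case by (auto simp: side_test_eq_0[OF W(1)])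
next
  case (S \<Phi>)
  then show ?case by (auto simp: side_test_eq_0[OF S(1)])
next
  case (E \<Phi>)
  then show ?case by (auto simp: side_test_eq_0[OF E(1)])
next
  case (N \<Phi>)
  then show ?case by (auto simp: side_test_eq_0[OF N(1)])
next
  case (lincomb \<Phi> \<Xi> s t)
  then show ?case by (simp add: Tmat_lincomb)
qed

lemma adjoint_core_dissipative:
  assumes "adjoint_core L1 L2 a1 b1 a2 b2 \<Phi>" and "0 < L1" "0 < L2" "0 < a1" "0 < a2"
  shows "L2_inner (Omega L1 L2) (formal_T a1 b1 a2 b2 \<Phi>) \<Phi> \<le> 0"
  using adjoint_core_boundary[OF assms(1-3)] adjoint_core_smooth2[OF assms(1)] assms
  by (intro formal_T_dissipative) auto

text \<open>An interior test field is a west-side test field that is zero on that side, so testing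
  against the core includes the weak equation.\<close>

lemma adjoint_core_test_fun:
  assumes "test_fun (Omega L1 L2) \<Phi>"
  shows "adjoint_core L1 L2 a1 b1 a2 b2 \<Phi>"
proof (rule adjoint_core.W)
  show *: "side_test L1 L2 ({0..<L1} \<times> {0<..<L2}) \<Phi>"
    using assms by (force simp: test_fun_def side_test_def Omega_def)
  have "\<Phi> (0, y) = 0" for y
    using assms closure_subset[of "{p. \<Phi> p \<noteq> 0}"] by (auto simp: test_fun_def Omega_def)
  then show "snd (Tmat a1 b1 (\<Phi> (0, y))) = 0" for y
    by simp
qed

text \<open>States that the adjoint of S is contained in T: the weak equation and all four trace
  conditions are instances of one Green identity tested on the core.\<close>

lemma T_graphI:
  assumes "in_L2 (Omega L1 L2) \<Theta>" and "in_L2 (Omega L1 L2) F"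
    and "\<And>\<Phi>. adjoint_core L1 L2 a1 b1 a2 b2 \<Phi> \<Longrightarrow> green L1 L2 a1 b1 a2 b2 \<Theta> F \<Phi> = 0"
  shows "T_graph L1 L2 a1 b1 a2 b2 \<Theta> F"
  unfolding T_graph_def weak_T_def bc_W_def bc_S_def bc_E_def bc_N_def
  using assms by (blast intro: adjoint_core_test_fun adjoint_core.W adjoint_core.S adjoint_core.E adjoint_core.N)

section \<open>Pairs of square integrable functions and limits of the form\<close>

text \<open>The squared norm of a pair is the sum of the squared norms, so the product-valued L^2
  space carries the graph inner product.\<close>

lemma L2_fun_Pair_iff:
  "L2_fun M (\<lambda>x. (f x, g x)) \<longleftrightarrow> L2_fun M f \<and> L2_fun M g"
proof
  assume *: "L2_fun M (\<lambda>x. (f x, g x))"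
  then have m: "(\<lambda>x. (f x, g x)) \<in> borel_measurable M"
    by (rule L2_fun_measurable)
  have [measurable]: "f \<in> borel_measurable M" "g \<in> borel_measurable M"
    using borel_measurable_continuous_on[OF continuous_on_fst[OF continuous_on_id] m]
      borel_measurable_continuous_on[OF continuous_on_snd[OF continuous_on_id] m] by simp_all
  have "integrable M (\<lambda>x. (norm (f x))\<^sup>2 + (norm (g x))\<^sup>2)"
    using L2_fun_integrable_sq[OF *] by (simp add: norm_Pair)
  then have "integrable M (\<lambda>x. (norm (f x))\<^sup>2)" "integrable M (\<lambda>x. (norm (g x))\<^sup>2)"
    by (auto intro: Bochner_Integration.integrable_bound)
  then show "L2_fun M f \<and> L2_fun M g"
    by (simp add: L2_fun_def)
next
  assume "L2_fun M f \<and> L2_fun M g"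
  then show "L2_fun M (\<lambda>x. (f x, g x))"
    by (auto simp: L2_fun_def norm_Pair intro: borel_measurable_Pair)
qed

lemma continuous_L2_fun_Omega:
  fixes g :: "real \<times> real \<Rightarrow> 'b::euclidean_space"
  assumes "continuous_on UNIV g"
  shows "L2_fun (lebesgue_on (Omega L1 L2)) g"
  unfolding L2_fun_def using continuous_integrable_Omega[OF assms]
  by (auto intro!: continuous_integrable_Omega continuous_intros assms)

text \<open>For z = (\<Psi>, G) the form \<open>snd z \<bullet> fst z\<close> is the integrand of
  the pairing to be shown nonnegative. Expanding it at w, Young's inequality puts the small weight
  \<delta> on z and 1 / \<delta> on the difference; the extra 1 absorbs the product of the two
  components of the difference.\<close>

lemma snd_inner_fst_perturbation:
  fixes z w :: "'b::real_inner \<times> 'b"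
  assumes "\<delta> > 0"
  shows "snd w \<bullet> fst w \<le> snd z \<bullet> fst z + \<delta> * (norm z)\<^sup>2 + (1 / \<delta> + 1) * (norm (z - w))\<^sup>2"
proof -
  obtain u v where z: "z = (u, v)" by (cases z)
  obtain a b where zw: "z - w = (a, b)" by (cases "z - w")
  have w: "w = (u - a, v - b)"
    using zw by (cases w) (simp add: z algebra_simps)
  have young: "\<bar>x \<bullet> y\<bar> \<le> \<delta> * (norm x)\<^sup>2 + (1 / \<delta>) * (norm y)\<^sup>2" for x y :: 'b
    \<comment> \<open>The reciprocal scalings leave the inner product unchanged.\<close>
    using abs_inner_le_sum_squares[of "sqrt \<delta> *\<^sub>R x" "(1 / sqrt \<delta>) *\<^sub>R y"] assms
    by (simp add: power_mult_distrib power_divide)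
  have "snd w \<bullet> fst w = v \<bullet> u - v \<bullet> a - u \<bullet> b + b \<bullet> a"
    by (simp add: w inner_simps inner_commute algebra_simps)
  also have "\<dots> \<le> v \<bullet> u + (\<delta> * (norm v)\<^sup>2 + (1 / \<delta>) * (norm a)\<^sup>2)
      + (\<delta> * (norm u)\<^sup>2 + (1 / \<delta>) * (norm b)\<^sup>2) + ((norm b)\<^sup>2 + (norm a)\<^sup>2)"
    using young[of v a] young[of u b] abs_inner_le_sum_squares[of b a] by linarith
  also have "\<dots> = snd z \<bullet> fst z + \<delta> * (norm z)\<^sup>2 + (1 / \<delta> + 1) * (norm (z - w))\<^sup>2"
    unfolding zw by (simp add: z norm_Pair algebra_simps)
  finally show ?thesis .
qed

text \<open>The perturbation bound is integrated; first n tends to infinity with \<delta> fixed,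
  which removes the difference term, and then \<delta> tends to 0.\<close>

lemma L2_limit_snd_inner_fst_nonneg:
  fixes f :: "'a \<Rightarrow> 'b::euclidean_space \<times> 'b"
  assumes f: "L2_fun M f" and d: "\<And>n. L2_fun M (d n)"
    and lim: "(\<lambda>n::nat. LINT x|M. (norm (f x - d n x))\<^sup>2) \<longlonglongrightarrow> 0"
    and nonneg: "\<And>n. 0 \<le> (LINT x|M. snd (d n x) \<bullet> fst (d n x))"
  shows "0 \<le> (LINT x|M. snd (f x) \<bullet> fst (f x))"
proof -
  have int: "integrable M (\<lambda>x. snd (g x) \<bullet> fst (g x))" if "L2_fun M g" for g :: "'a \<Rightarrow> 'b \<times> 'b"
    using L2_fun_Pair_iff[of M "\<lambda>x. fst (g x)" "\<lambda>x. snd (g x)"] that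
    by (simp add: L2_fun_integrable_inner)
  define A where "A = (LINT x|M. (norm (f x))\<^sup>2)"
  define Q where "Q = (LINT x|M. snd (f x) \<bullet> fst (f x))"
  have A: "A \<ge> 0" by (simp add: A_def)
  have \<delta>: "0 \<le> Q + \<delta> * A" if "\<delta> > 0" for \<delta>
  proof -
    have "0 \<le> Q + \<delta> * A + (1 / \<delta> + 1) * (LINT x|M. (norm (f x - d n x))\<^sup>2)" for n
    proof -
      note fd = L2_fun_integrable_sq[OF L2_fun_diff[OF f d[of n]]]
      have "(LINT x|M. snd (d n x) \<bullet> fst (d n x))
          \<le> (LINT x|M. snd (f x) \<bullet> fst (f x) + \<delta> * (norm (f x))\<^sup>2 + (1 / \<delta> + 1) * (norm (f x - d n x))\<^sup>2)"
        using int[OF f] int[OF d[of n]] fd L2_fun_integrable_sq[OF f]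
        by (intro integral_mono snd_inner_fst_perturbation that) auto
      also have "\<dots> = Q + \<delta> * A + (1 / \<delta> + 1) * (LINT x|M. (norm (f x - d n x))\<^sup>2)"
        using int[OF f] fd L2_fun_integrable_sq[OF f] by (simp add: A_def Q_def)
      finally show ?thesis
        using nonneg[of n] by linarith
    qed
    moreover have "(\<lambda>n. Q + \<delta> * A + (1 / \<delta> + 1) * (LINT x|M. (norm (f x - d n x))\<^sup>2))
        \<longlonglongrightarrow> Q + \<delta> * A + (1 / \<delta> + 1) * 0"
      by (intro tendsto_intros lim)
    ultimately show ?thesis
      by (auto dest: LIMSEQ_le_const)
  qed
  have "0 \<le> Q + e" if "e > 0" for e
  proof -
    \<comment> \<open>The denominator A + 1 makes the choice of \<delta> legitimate even when A =
      0.\<close>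
    have "e / (A + 1) * A \<le> e"
      using A that by (simp add: field_simps)
    moreover have "e / (A + 1) > 0"
      using A that by simp
    ultimately show ?thesis
      using \<delta>[of "e / (A + 1)"] by linarith
  qed
  then show ?thesis
    unfolding Q_def by (rule field_le_epsilon)
qed

section \<open>Positivity of the adjoint\<close>

theorem theorem4p4:
  fixes L1 L2 \<alpha>1 \<alpha>2 \<beta>1 \<beta>2 :: real
    and \<Psi> G :: "real \<times> real \<Rightarrow> real \<times> real"
  assumes "L1 > 0" and "L2 > 0" and "\<alpha>1 > 0" and "\<alpha>2 > 0"
    and "\<alpha>2 * \<beta>1 - \<alpha>1 * \<beta>2 \<noteq> 0"
    and "Tadj_graph L1 L2 \<alpha>1 \<beta>1 \<alpha>2 \<beta>2 \<Psi> G"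
  shows "L2_inner (Omega L1 L2) G \<Psi> \<ge> 0"
proof -
  let ?M = "lebesgue_on (Omega L1 L2)"
  let ?T = "formal_T \<alpha>1 \<beta>1 \<alpha>2 \<beta>2"
  let ?core = "adjoint_core L1 L2 \<alpha>1 \<beta>1 \<alpha>2 \<beta>2"
  \<comment> \<open>D is the graph of S.\<close>
  define D where "D = {d. \<exists>\<Phi>. ?core \<Phi> \<and> d = (\<lambda>p. (\<Phi> p, - ?T \<Phi> p))}"
  define f where "f = (\<lambda>p. (\<Psi> p, G p))"
  have T: "continuous_on UNIV (?T \<Phi>)" if "?core \<Phi>" for \<Phi>
    using adjoint_core_smooth2[OF that] unfolding formal_T_def
    by (intro continuous_intros smooth2_continuous_on smooth2_dx smooth2_dy)
  have core_L2: "L2_fun ?M \<Phi>" "L2_fun ?M (?T \<Phi>)" if "?core \<Phi>" for \<Phi>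
    using adjoint_core_smooth2[OF that] T[OF that]
    by (auto intro: continuous_L2_fun_Omega smooth2_continuous_on)
  have D_L2: "L2_fun ?M d" if d: "d \<in> D" for d
  proof -
    obtain \<Phi> where "?core \<Phi>" and "d = (\<lambda>p. (\<Phi> p, - ?T \<Phi> p))"
      using d by (auto simp: D_def)
    then show ?thesis
      using core_L2(1) L2_fun_minus[OF core_L2(2)] by (simp only: L2_fun_Pair_iff)
  qed
  interpret finite_measure ?M
    by (rule finite_measure_lebesgue_on) (simp add: Omega_eq_box lmeasurable_box)
  have f: "L2_fun ?M f"
    using assms(6) by (simp add: f_def L2_fun_Pair_iff Tadj_graph_def in_L2_iff_L2_fun)
  have lin: "(\<lambda>p. s *\<^sub>R c p + t *\<^sub>R d p) \<in> D" if cd: "c \<in> D" "d \<in> D" for c d s t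
  proof -
    obtain \<Phi> \<Xi> where "?core \<Phi>" "?core \<Xi>"
      and c: "c = (\<lambda>p. (\<Phi> p, - ?T \<Phi> p))" and d: "d = (\<lambda>p. (\<Xi> p, - ?T \<Xi> p))"
      using cd by (auto simp: D_def)
    let ?L = "\<lambda>p. s *\<^sub>R \<Phi> p + t *\<^sub>R \<Xi> p"
    have "?core ?L"
      using \<open>?core \<Phi>\<close> \<open>?core \<Xi>\<close>
      by (rule adjoint_core.lincomb)
    moreover have "(\<lambda>p. s *\<^sub>R c p + t *\<^sub>R d p) = (\<lambda>p. (?L p, - ?T ?L p))"
      using \<open>?core \<Phi>\<close> \<open>?core \<Xi>\<close>
      by (simp add: c d fun_eq_iff formal_T_def adjoint_core_smooth2 dx_lincomb dy_lincomb Tmat_lincomb algebra_simps)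
    ultimately show ?thesis
      by (auto simp: D_def)
  qed
  have orth: "(LINT p|?M. e p \<bullet> f p) = 0"
    if e: "L2_fun ?M e" and eD: "\<And>d. d \<in> D \<Longrightarrow> (LINT p|?M. e p \<bullet> d p) = 0" for e
  proof -
    \<comment> \<open>With e = (A, -B), pairing e with (\<Phi>, \<open>- ?T \<Phi>\<close>) gives
      the integral of A.\<Phi> + B.\<open>?T \<Phi>\<close>, which is exactly the Green functional
      of B and A; pairing e with f gives the difference of the two sides of the adjoint
      relation.\<close>
    define A B where "A p = fst (e p)" and "B p = - snd (e p)" for p
    have "L2_fun ?M (\<lambda>p. (A p, - B p))"
      using e by (simp add: A_def B_def)
    then have AB: "L2_fun ?M A" "L2_fun ?M B"
      using L2_fun_minus[of ?M "\<lambda>p. - B p"] by (auto simp: L2_fun_Pair_iff)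
    have pointwise: "e p \<bullet> (x, y) = A p \<bullet> x - B p \<bullet> y" for p x y
      unfolding A_def B_def inner_minus_left by (simp add: inner_prod_def)
    have e_inner: "(LINT p|?M. e p \<bullet> (u p, v p)) = L2_inner (Omega L1 L2) A u - L2_inner (Omega L1 L2) B v"
      if "L2_fun ?M u" "L2_fun ?M v" for u v
      using L2_fun_integrable_inner[OF AB(1) that(1)] L2_fun_integrable_inner[OF AB(2) that(2)]
      by (simp add: L2_inner_def pointwise)
    have "T_graph L1 L2 \<alpha>1 \<beta>1 \<alpha>2 \<beta>2 B A"
    proof (rule T_graphI)
      fix \<Phi> assume \<Phi>: "?core \<Phi>"
      have "(LINT p|?M. e p \<bullet> (\<Phi> p, - ?T \<Phi> p)) = 0"
        using \<Phi> by (intro eD) (auto simp: D_def)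
      then show "green L1 L2 \<alpha>1 \<beta>1 \<alpha>2 \<beta>2 B A \<Phi> = 0"
        using e_inner[OF core_L2(1)[OF \<Phi>] L2_fun_minus[OF core_L2(2)[OF \<Phi>]]]
        by (simp add: green_def L2_inner_def formal_T_def[symmetric])
    qed (use AB in \<open>simp_all add: in_L2_iff_L2_fun\<close>)
    with assms(6) have "L2_inner (Omega L1 L2) A \<Psi> = L2_inner (Omega L1 L2) B G"
      by (simp add: Tadj_graph_def)
    then show ?thesis
      using e_inner[of \<Psi> G] f by (simp add: f_def L2_fun_Pair_iff)
  qed
  have "D \<noteq> {}"
    using exI[of ?core, OF adjoint_core_zero] by (simp add: D_def)
  from L2_approximable_if_orthogonal[OF f D_L2 this lin orth]
  obtain d where d: "\<And>n::nat. d n \<in> D" "(\<lambda>n. LINT p|?M. (norm (f p - d n p))\<^sup>2) \<longlonglongrightarrow> 0"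
    by blast
  \<comment> \<open>On the graph of S the form is the pairing of S \<Phi> with \<Phi>, so
    dissipativity of the formal operator gives its sign.\<close>
  have "0 \<le> (LINT p|?M. snd (d n p) \<bullet> fst (d n p))" for n
  proof -
    obtain \<Phi> where \<Phi>: "?core \<Phi>" and dn: "d n = (\<lambda>p. (\<Phi> p, - ?T \<Phi> p))"
      using d(1)[of n] by (auto simp: D_def)
    have "(LINT p|?M. snd (d n p) \<bullet> fst (d n p)) = - L2_inner (Omega L1 L2) (?T \<Phi>) \<Phi>"
      unfolding dn L2_inner_def by simp
    with adjoint_core_dissipative[OF \<Phi> assms(1-4)] show ?thesis
      by simp
  qed
  from L2_limit_snd_inner_fst_nonneg[OF f D_L2[OF d(1)] d(2) this]
  show ?thesis
    by (simp add: f_def L2_inner_def)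
qed

end
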